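(* There is an absolute constant $C$ such that for all $n$ large enough, there exist $c\in\mathbb{R}_{\ge 0}^n$ with $\|c - \mathbf{1}\|_1 < 2$ and a matrix $M \in \mathrm{Mat}_n(c)$ with at most $Cn$ non-zero entries such that $$\mathrm{per}(M) < \mathrm{per}\left(\tfrac{1}{n} \mathbf{1} c^\top\right), \qquad \text{where } \tfrac{1}{n} \mathbf{1} c^\top \in \mathrm{Mat}_n(c).$$
   Context: For $c \in \mathbb{R}_{\ge 0}^n$, $\mathrm{Mat}_n(c)$ is the set of $n\times n$ real matrices with non-negative entries, all row sums equal to $1$, and column sums $c_1,\dots,c_n$. $\mathrm{per}$ denotes the permanent, $\mathbf 1$ the all-ones (column) vector and $\|\cdot\|_1$ the $\ell^1$ norm. *)

theory Defs
  imports Complex_Main "HOL-Combinatorics.Permutations" "Jordan_Normal_Form.Matrix"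
begin

(* Same shape as Determinant.det (including the value 0 on non-square matrices), without the signs. *)
definition permanent :: "'a :: comm_semiring_1 mat \<Rightarrow> 'a" where
  "permanent A = (if dim_row A = dim_col A then
     (\<Sum>p \<in> {p. p permutes {0..<dim_row A}}. \<Prod>i = 0..<dim_row A. A $$ (i, p i)) else 0)"

definition nonneg_vecs :: "nat \<Rightarrow> real vec set" where
  "nonneg_vecs n = {c \<in> carrier_vec n. \<forall>i<n. 0 \<le> c $ i}"

definition all_ones :: "nat \<Rightarrow> real vec" where
  "all_ones n = vec n (\<lambda>_. 1)"

definition l1_norm :: "real vec \<Rightarrow> real" where
  "l1_norm v = (\<Sum>i<dim_vec v. \<bar>v $ i\<bar>)"

definition Mat_class :: "nat \<Rightarrow> real vec \<Rightarrow> real mat set" where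
  "Mat_class n c = {M \<in> carrier_mat n n.
     (\<forall>i<n. \<forall>j<n. 0 \<le> M $$ (i, j)) \<and>
     (\<forall>i<n. (\<Sum>j<n. M $$ (i, j)) = 1) \<and>
     (\<forall>j<n. (\<Sum>i<n. M $$ (i, j)) = c $ j)}"

definition nonzero_entries :: "real mat \<Rightarrow> (nat \<times> nat) set" where
  "nonzero_entries M = {(i, j). i < dim_row M \<and> j < dim_col M \<and> M $$ (i, j) \<noteq> 0}"

(* (1/n) 1 c^T: the column vector 1 and the row vector c^T are an n x 1 and a 1 x n matrix. *)
definition uniform_mat :: "nat \<Rightarrow> real vec \<Rightarrow> real mat" where
  "uniform_mat n c = (1 / real n) \<cdot>\<^sub>m (mat_of_cols n [all_ones n] * mat_of_row c)"

lemma uniform_mat_carrier: "c \<in> carrier_vec n \<Longrightarrow> uniform_mat n c \<in> carrier_mat n n"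
  by (auto simp: uniform_mat_def mat_of_row_def)

lemma uniform_mat_index:
  assumes "c \<in> carrier_vec n" "i < n" "j < n"
  shows "uniform_mat n c $$ (i, j) = c $ j / real n"
  using assms
  by (auto simp: uniform_mat_def mat_of_row_def all_ones_def scalar_prod_def mat_of_cols_index)

end

theory Submission
  imports Defs
begin

text \<open>
  The permanent vanishes as soon as two rows are supported on a single column, and such matrices
  can already sit on the boundary \<open>\<parallel>c - 1\<parallel> = 2\<close>; the example is a small perturbation of one.
  Give the first two rows mass \<open>1 - d\<close> in the first column and \<open>d\<close> in the second, and let the
  remaining rows form a band with entries \<open>1/2\<close>. Every permutation product then contains a factor
  at most \<open>d\<close>, whereas the products of the uniform matrix are at least \<open>1 / (2n)\<^sup>n\<close> because
  all column sums are at least \<open>1/2\<close>; so any sufficiently small \<open>d\<close> (depending on \<open>n\<close>) works.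
\<close>

text \<open>Only the row sums need an argument: each equals the total of \<open>c\<close> over
  \<open>n\<close>, and counting the entries of any \<open>M\<close> in the class by columns and by
  rows shows that this total is \<open>n\<close>.\<close>

lemma uniform_mat_in_Mat_class:
  assumes "M \<in> Mat_class n c" "c \<in> nonneg_vecs n" "n > 0"
  shows "uniform_mat n c \<in> Mat_class n c"
proof -
  have c: "c \<in> carrier_vec n" "\<And>j. j < n \<Longrightarrow> 0 \<le> c $ j"
    using assms(2) by (auto simp: nonneg_vecs_def)
  have "(\<Sum>j<n. c $ j) = (\<Sum>j<n. \<Sum>i<n. M $$ (i, j))"
    using assms(1) by (intro sum.cong) (auto simp: Mat_class_def)
  also have "\<dots> = (\<Sum>i<n. \<Sum>j<n. M $$ (i, j))" by (rule sum.swap)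
  also have "\<dots> = real n"
    using assms(1) by (simp add: Mat_class_def)
  finally have total: "(\<Sum>j<n. c $ j) = real n" .
  show ?thesis
    using c assms(3) uniform_mat_carrier[OF c(1)]
    by (auto simp: Mat_class_def uniform_mat_index sum_divide_distrib[symmetric] total)
qed

lemma permanent_strict_mono:
  fixes A B :: "real mat"
  assumes "A \<in> carrier_mat n n" "B \<in> carrier_mat n n"
    and "\<And>p. p permutes {0..<n} \<Longrightarrow> (\<Prod>i = 0..<n. A $$ (i, p i)) < (\<Prod>i = 0..<n. B $$ (i, p i))"
  shows "permanent A < permanent B"
proof -
  have "finite {p. p permutes {0..<n}}" by (simp add: finite_permutations)
  moreover have "{p. p permutes {0..<n}} \<noteq> {}" using permutes_id by blast
  ultimately show ?thesis
    using assms by (auto simp: permanent_def intro!: sum_strict_mono)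
qed

definition band_entry :: "real \<Rightarrow> nat \<Rightarrow> nat \<Rightarrow> real" where
  "band_entry d i j =
    (if i < 2 then (if j = 0 then 1 - d else if j = 1 then d else 0)
     else if j = i \<or> Suc j = i then 1/2 else 0)"

definition band_mat :: "real \<Rightarrow> nat \<Rightarrow> real mat" where
  "band_mat d n = mat n n (\<lambda>(i, j). band_entry d i j)"

text \<open>Column 0 meets only the two special rows. Column 1 meets both of them and also the 1/2
  left of the diagonal in row 2. The last column has no row below it to supply a second 1/2.\<close>

definition band_col_sums :: "real \<Rightarrow> nat \<Rightarrow> real vec" where
  "band_col_sums d n = vec n (\<lambda>j. if j = 0 then 2 - 2*d else if j = 1 then 1/2 + 2*d
     else if Suc j = n then 1/2 else 1)"

lemma band_row_sum:
  assumes "n \<ge> 3" "i < n"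
  shows "(\<Sum>j<n. band_entry d i j) = 1"
proof (cases "i < 2")
  case True
  have "(\<Sum>j<n. band_entry d i j) = (\<Sum>j\<in>{0,1}. band_entry d i j)"
    using assms True by (intro sum.mono_neutral_right) (auto simp: band_entry_def)
  then show ?thesis using True by (simp add: band_entry_def)
next
  case False
  have "(\<Sum>j<n. band_entry d i j) = (\<Sum>j\<in>{i - 1, i}. band_entry d i j)"
    using assms False by (intro sum.mono_neutral_right) (auto simp: band_entry_def)
  also have "\<dots> = 1" using False by (auto simp: band_entry_def)
  finally show ?thesis .
qed

lemma band_col_sum:
  assumes "n \<ge> 3" "j < n"
  shows "(\<Sum>i<n. band_entry d i j) = band_col_sums d n $ j"
proof -
  consider "j = 0" | "j = 1" | "j \<ge> 2" "Suc j = n" | "j \<ge> 2" "Suc j < n"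
    using assms by linarith
  then show ?thesis
  proof cases
    case 1
    have "(\<Sum>i<n. band_entry d i j) = (\<Sum>i\<in>{0,1}. band_entry d i j)"
      using assms 1 by (intro sum.mono_neutral_right) (auto simp: band_entry_def)
    then show ?thesis using assms 1 by (simp add: band_entry_def band_col_sums_def)
  next
    case 2
    have "(\<Sum>i<n. band_entry d i j) = (\<Sum>i\<in>{0,1,2}. band_entry d i j)"
      using assms 2 by (intro sum.mono_neutral_right) (auto simp: band_entry_def)
    then show ?thesis using assms 2 by (simp add: band_entry_def band_col_sums_def)
  next
    case 3
    have "(\<Sum>i<n. band_entry d i j) = (\<Sum>i\<in>{j}. band_entry d i j)"
      using assms 3 by (intro sum.mono_neutral_right) (auto simp: band_entry_def)
    then show ?thesis using assms 3 by (simp add: band_entry_def band_col_sums_def)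
  next
    case 4
    have "(\<Sum>i<n. band_entry d i j) = (\<Sum>i\<in>{j, Suc j}. band_entry d i j)"
      using assms 4 by (intro sum.mono_neutral_right) (auto simp: band_entry_def)
    then show ?thesis using assms 4 by (simp add: band_entry_def band_col_sums_def)
  qed
qed

lemma band_mat_in_Mat_class:
  assumes "n \<ge> 3" "0 \<le> d" "d \<le> 1"
  shows "band_mat d n \<in> Mat_class n (band_col_sums d n)"
  using assms band_row_sum[OF assms(1)] band_col_sum[OF assms(1)]
  by (auto simp: Mat_class_def band_mat_def) (auto simp: band_entry_def)

lemma band_col_sums_nonneg:
  assumes "0 \<le> d" "d \<le> 1"
  shows "band_col_sums d n \<in> nonneg_vecs n"
  using assms by (auto simp: nonneg_vecs_def band_col_sums_def)

text \<open>Only columns 0, 1 and \<open>n - 1\<close> deviate from 1, by 1 - 2d, 1/2 - 2d and 1/2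
  in absolute value; \<open>d \<le> 1/4\<close> settles the signs. Hence every positive
  \<open>d\<close> gives a norm strictly below 2.\<close>

lemma l1_norm_band_col_sums:
  assumes "n \<ge> 3" "0 \<le> d" "d \<le> 1/4"
  shows "l1_norm (band_col_sums d n - all_ones n) = 2 - 4 * d"
proof -
  let ?f = "\<lambda>j. \<bar>(band_col_sums d n - all_ones n) $ j\<bar>"
  have "l1_norm (band_col_sums d n - all_ones n) = (\<Sum>j<n. ?f j)"
    by (simp add: l1_norm_def all_ones_def)
  also have "\<dots> = (\<Sum>j\<in>{0, 1, n - 1}. ?f j)"
    using assms by (intro sum.mono_neutral_right) (auto simp: band_col_sums_def all_ones_def)
  also have "\<dots> = 2 - 4 * d"
    using assms by (simp add: band_col_sums_def all_ones_def)
  finally show ?thesis .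
qed

lemma card_nonzero_entries_band_mat: "card (nonzero_entries (band_mat d n)) \<le> 2 * n"
proof -
  \<comment> \<open>The two maps list the only two positions per row that can be nonzero.\<close>
  let ?f = "\<lambda>i. (i, if i < 2 then 0 else i)" and ?g = "\<lambda>i. (i, if i < 2 then 1 else i - 1)"
  have "nonzero_entries (band_mat d n) \<subseteq> ?f ` {..<n} \<union> ?g ` {..<n}"
    by (auto simp: nonzero_entries_def band_mat_def band_entry_def image_iff split: if_splits)
  then have "card (nonzero_entries (band_mat d n)) \<le> card (?f ` {..<n} \<union> ?g ` {..<n})"
    by (intro card_mono) auto
  also have "\<dots> \<le> card (?f ` {..<n}) + card (?g ` {..<n})" by (rule card_Un_le)
  also have "\<dots> \<le> n + n"
    using card_image_le[of "{..<n}" ?f] card_image_le[of "{..<n}" ?g] by simp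
  finally show ?thesis by simp
qed

lemma band_mat_prod_le:
  assumes "n \<ge> 2" "0 \<le> d" "d \<le> 1" "p permutes {0..<n}"
  shows "(\<Prod>i = 0..<n. band_mat d n $$ (i, p i)) \<le> d"
proof -
  have eq: "(\<Prod>i = 0..<n. band_mat d n $$ (i, p i)) = (\<Prod>i = 0..<n. band_entry d i (p i))"
    using permutes_in_image[OF assms(4)] by (intro prod.cong) (auto simp: band_mat_def)
  \<comment> \<open>Rows 0 and 1 cannot both use column 0, so one of them, row \<open>k\<close>,
    contributes \<open>d\<close> or 0.\<close>
  have "p 0 \<noteq> p 1" using permutes_inj[OF assms(4)] by (metis injD zero_neq_one)
  then obtain k where k: "k < 2" "p k \<noteq> 0"
    by (metis less_2_cases_iff One_nat_def)
  have "(\<Prod>i = 0..<n. band_entry d i (p i))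
      = band_entry d k (p k) * (\<Prod>i \<in> {0..<n} - {k}. band_entry d i (p i))"
    using k assms(1) by (intro prod.remove) auto
  \<comment> \<open>All the other factors lie in [0, 1].\<close>
  also have "\<dots> \<le> d * 1"
    using k assms(2,3)
    by (intro mult_mono prod_le_1 prod_nonneg) (auto simp: band_entry_def)
  finally show ?thesis using eq by simp
qed

lemma uniform_mat_prod_ge:
  assumes "c \<in> carrier_vec n" "0 \<le> b" "\<And>j. j < n \<Longrightarrow> b \<le> c $ j" "p permutes {0..<n}"
  shows "(b / real n) ^ n \<le> (\<Prod>i = 0..<n. uniform_mat n c $$ (i, p i))"
proof -
  have "(\<Prod>i = 0..<n. b / real n) \<le> (\<Prod>i = 0..<n. uniform_mat n c $$ (i, p i))"
    using assms permutes_in_image[OF assms(4)]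
    by (intro prod_mono) (auto simp: uniform_mat_index divide_right_mono)
  then show ?thesis by simp
qed

theorem proposition2p4:
  shows "\<exists>C :: real. \<exists>N :: nat. \<forall>n \<ge> N.
    \<exists>c \<in> nonneg_vecs n. l1_norm (c - all_ones n) < 2 \<and>
      (\<exists>M \<in> Mat_class n c.
        real (card (nonzero_entries M)) \<le> C * real n \<and>
        uniform_mat n c \<in> Mat_class n c \<and>
        permanent M < permanent (uniform_mat n c))"
\<comment> \<open>The constant 2 counts the possible nonzero entries per row; from
  \<open>n = 3\<close> on, the columns 0, 1 and \<open>n - 1\<close> are distinct.\<close>
proof (rule exI[of _ 2], rule exI[of _ 3], intro allI impI)
  fix n :: nat
  assume n: "n \<ge> 3"
  \<comment> \<open>The factor 1/4 serves twice: it puts \<open>d\<close> strictly below the lower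
    bound for the uniform products, and it gives \<open>d \<le> 1/4\<close>.\<close>
  define d :: real where "d = ((1/2) / real n) ^ n / 4"
  define c where "c = band_col_sums d n"
  have "((1/2) / real n) ^ n \<le> 1"
    using n by (intro power_le_one) (auto simp: field_simps)
  then have d: "0 < d" "d \<le> 1/4" using n by (auto simp: d_def)
  have c: "c \<in> nonneg_vecs n" "c \<in> carrier_vec n"
    using band_col_sums_nonneg[of d n] d by (auto simp: c_def nonneg_vecs_def)
  have M: "band_mat d n \<in> Mat_class n c"
    using band_mat_in_Mat_class[OF n] d by (simp add: c_def)
  have "permanent (band_mat d n) < permanent (uniform_mat n c)"
  proof (rule permanent_strict_mono)
    fix p assume p: "p permutes {0..<n}"
    have "(\<Prod>i = 0..<n. band_mat d n $$ (i, p i)) \<le> d"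
      using band_mat_prod_le[OF _ _ _ p] n d by simp
    also have "d < ((1/2) / real n) ^ n" using n by (simp add: d_def)
    \<comment> \<open>Here \<open>b\<close> is 1/2: column 0 has sum at least 3/2 since
      \<open>d \<le> 1/4\<close>, and the other column sums are at least 1/2.\<close>
    also have "\<dots> \<le> (\<Prod>i = 0..<n. uniform_mat n c $$ (i, p i))"
      using d by (intro uniform_mat_prod_ge[OF c(2) _ _ p]) (auto simp: c_def band_col_sums_def)
    finally show "(\<Prod>i = 0..<n. band_mat d n $$ (i, p i))
        < (\<Prod>i = 0..<n. uniform_mat n c $$ (i, p i))" .
  qed (use uniform_mat_carrier[OF c(2)] in \<open>auto simp: band_mat_def\<close>)
  moreover have "l1_norm (c - all_ones n) < 2"
    using l1_norm_band_col_sums[OF n] d by (simp add: c_def)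
  moreover have "real (card (nonzero_entries (band_mat d n))) \<le> 2 * real n"
    using card_nonzero_entries_band_mat[of d n] by linarith
  moreover have "uniform_mat n c \<in> Mat_class n c"
    using uniform_mat_in_Mat_class[OF M c(1)] n by simp
  ultimately show "\<exists>c \<in> nonneg_vecs n. l1_norm (c - all_ones n) < 2 \<and>
      (\<exists>M \<in> Mat_class n c.
        real (card (nonzero_entries M)) \<le> 2 * real n \<and>
        uniform_mat n c \<in> Mat_class n c \<and>
        permanent M < permanent (uniform_mat n c))"
    using c(1) M by blast
qed

end
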